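(* Let $n\ge 2$, let $A=[a_{ij}]\in M_n$ be a nonsingular $M$-matrix and $A^{-1}=[\alpha_{ij}]$. Then, for every $t=1,2,\ldots$, $$\tau(A)\geq\frac{2}{\max\limits_{i\neq j}\Big\{\alpha_{ii}+\alpha_{jj}+\Big[(\alpha_{ii}-\alpha_{jj})^2+4\alpha_{ii}\alpha_{jj}\Big(\sum\limits_{k\neq i}p_{ki}^{(t)}\Big)\Big(\sum\limits_{k\neq j}p_{kj}^{(t)}\Big)\Big]^{\frac12}\Big\}}.$$
   Context: Let $N=\{1,\ldots,n\}$, $n\ge2$. All indices range over $N$. A matrix is called nonnegative ($\ge 0$) if all its entries are nonnegative. A matrix $A=[a_{ij}]\in\mathbb{R}^{n\times n}$ is a nonsingular $M$-matrix if $a_{ij}\le 0$ for all $i\ne j$ and $A$ is invertible with $A^{-1}\ge 0$; $M_n$ denotes the set of all $n\times n$ nonsingular $M$-matrices. For $A\in M_n$, $\tau(A)=\rho(A^{-1})^{-1}$, where $\rho$ denotes the spectral radius (the minimum eigenvalue of $A$; equivalently $\tau(A)=\min\{|\lambda|:\lambda\in\sigma(A)\}$). For $A=[a_{ij}]$ with $a_{ii}\ne0$, for $i,j\in N$, $j\ne i$, and $t=1,2,\ldots$, define $$r_i=\max_{j\neq i}\frac{|a_{ji}|}{|a_{jj}|-\sum_{k\ne j,i}|a_{jk}|},\qquad m_{ji}=\frac{|a_{ji}|+\sum_{k\ne j,i}|a_{jk}|r_i}{|a_{jj}|},$$ $$h_i=\max_{j\ne i}\frac{|a_{ji}|}{|a_{jj}|m_{ji}-\sum_{k\ne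 j,i}|a_{jk}|m_{ki}},\qquad u_{ji}=\frac{|a_{ji}|+\sum_{k\ne j,i}|a_{jk}|m_{ki}h_i}{|a_{jj}|},\qquad u^{(0)}_{ji}=u_{ji},$$ and recursively $$p^{(t)}_{ji}=\frac{|a_{ji}|+\sum_{k\ne j,i}|a_{jk}|u^{(t-1)}_{ki}}{|a_{jj}|},\qquad h^{(t)}_i=\max_{j\ne i}\frac{|a_{ji}|}{|a_{jj}|p^{(t)}_{ji}-\sum_{k\ne j,i}|a_{jk}|p^{(t)}_{ki}},\qquad u^{(t)}_{ji}=\frac{|a_{ji}|+\sum_{k\ne j,i}|a_{jk}|p^{(t)}_{ki}h^{(t)}_i}{|a_{jj}|}.$$
   Formalization: The formal theorem additionally assumes that every denominator |a_jj| − Σ_{k≠j,i}|a_jk| occurring in r_i is positive; without this the claim is false (e.g. A=[[6,−1,0],[−4,2,−4],[0,−1,5]], t=1) or r_i is undefined. *)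

theory Defs
  imports
    "Jordan_Normal_Form.Gauss_Jordan_Elimination"
    "Jordan_Normal_Form.Spectral_Radius"
begin

(* Matrices are indexed from 0, so the index set N is {..<dim_row A}. *)

definition nonneg_mat :: "real mat \<Rightarrow> bool" where
  "nonneg_mat A \<longleftrightarrow> (\<forall>i < dim_row A. \<forall>j < dim_col A. 0 \<le> A $$ (i, j))"

(* Meaningful for invertible square matrices: mat_inverse returns None on singular ones. *)
definition inv_mat :: "real mat \<Rightarrow> real mat" where
  "inv_mat A = the (mat_inverse A)"

definition nonsingular_M_matrices :: "nat \<Rightarrow> real mat set" where
  "nonsingular_M_matrices n =
     {A \<in> carrier_mat n n.
        (\<forall>i < n. \<forall>j < n. i \<noteq> j \<longrightarrow> A $$ (i, j) \<le> 0) \<and>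
        invertible_mat A \<and> nonneg_mat (inv_mat A)}"

(* spectral_radius is defined for complex matrices only. *)
definition tau :: "real mat \<Rightarrow> real" where
  "tau A = inverse (spectral_radius (map_mat complex_of_real (inv_mat A)))"

definition off_sum :: "real mat \<Rightarrow> nat \<Rightarrow> nat \<Rightarrow> (nat \<Rightarrow> real) \<Rightarrow> real" where
  "off_sum A j i f = (\<Sum>k \<in> {..<dim_row A} - {j, i}. \<bar>A $$ (j, k)\<bar> * f k)"

(* In the quotients below x / 0 = 0. When |a_jj| > sum_{k \<noteq> j, i} |a_jk| for all
   i \<noteq> j, all denominators in r_coef are positive and those in h_of (as used in
   u_iter) are at least |a_ji|; so only 0 / 0 can occur there, and such a
   quotient does not affect the maximum, the other quotients being nonnegative. *)

definition r_coef :: "real mat \<Rightarrow> nat \<Rightarrow> real" where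
  "r_coef A i =
     Max ((\<lambda>j. \<bar>A $$ (j, i)\<bar> / (\<bar>A $$ (j, j)\<bar> - off_sum A j i (\<lambda>_. 1)))
            ` ({..<dim_row A} - {i}))"

definition m_coef :: "real mat \<Rightarrow> nat \<Rightarrow> nat \<Rightarrow> real" where
  "m_coef A j i = (\<bar>A $$ (j, i)\<bar> + off_sum A j i (\<lambda>_. r_coef A i)) / \<bar>A $$ (j, j)\<bar>"

(* h_i and u_ji arise from m_ji by the same formulas as h_i^(t) and u_ji^(t) from
   p_ji^(t); the argument x is the family x_ji they are computed from. *)

definition h_of :: "real mat \<Rightarrow> (nat \<Rightarrow> nat \<Rightarrow> real) \<Rightarrow> nat \<Rightarrow> real" where
  "h_of A x i =
     Max ((\<lambda>j. \<bar>A $$ (j, i)\<bar> / (\<bar>A $$ (j, j)\<bar> * x j i - off_sum A j i (\<lambda>k. x k i)))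
            ` ({..<dim_row A} - {i}))"

definition u_of :: "real mat \<Rightarrow> (nat \<Rightarrow> nat \<Rightarrow> real) \<Rightarrow> nat \<Rightarrow> nat \<Rightarrow> real" where
  "u_of A x j i =
     (\<bar>A $$ (j, i)\<bar> + off_sum A j i (\<lambda>k. x k i * h_of A x i)) / \<bar>A $$ (j, j)\<bar>"

definition p_of :: "real mat \<Rightarrow> (nat \<Rightarrow> nat \<Rightarrow> real) \<Rightarrow> nat \<Rightarrow> nat \<Rightarrow> real" where
  "p_of A u j i = (\<bar>A $$ (j, i)\<bar> + off_sum A j i (\<lambda>k. u k i)) / \<bar>A $$ (j, j)\<bar>"

primrec u_iter :: "real mat \<Rightarrow> nat \<Rightarrow> nat \<Rightarrow> nat \<Rightarrow> real" where
  "u_iter A 0 = u_of A (m_coef A)"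
| "u_iter A (Suc t) = u_of A (p_of A (u_iter A t))"

(* Only used for t \<ge> 1. *)
definition p_iter :: "real mat \<Rightarrow> nat \<Rightarrow> nat \<Rightarrow> nat \<Rightarrow> real" where
  "p_iter A t = p_of A (u_iter A (t - 1))"

end

theory Submission
  imports Defs
begin

text \<open>
  Write \<open>\<alpha>\<close> for the inverse of \<open>A\<close>. Since \<open>\<tau>(A)\<close> is the reciprocal of the spectral radius
  of \<open>\<alpha>\<close>, a lower bound for it is an upper bound for the moduli of the eigenvalues of \<open>\<alpha>\<close>.
  Brauer's theorem, applied to the columns of \<open>\<alpha>\<close>, puts each eigenvalue into an oval
  \<open>|l - \<alpha>\<^sub>i\<^sub>i| |l - \<alpha>\<^sub>j\<^sub>j| \<le> R\<^sub>i R\<^sub>j\<close> with \<open>R\<^sub>i\<close> the sum of the off-diagonal entries of column \<open>i\<close>,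
  and the largest modulus in such an oval is at most the larger root of
  \<open>(x - \<alpha>\<^sub>i\<^sub>i)(x - \<alpha>\<^sub>j\<^sub>j) = R\<^sub>i R\<^sub>j\<close> (lemmas \<open>brauer_cassini\<close> and \<open>cassini_oval_norm_bound\<close>).
  The expression maximised over \<open>i \<noteq> j\<close> in the theorem is twice that root, with \<open>R\<^sub>i\<close> replaced by
  \<open>\<alpha>\<^sub>i\<^sub>i\<close> times a sum of the \<open>p\<^sub>k\<^sub>i\<close>.

  It remains to see that \<open>\<alpha>\<^sub>j\<^sub>i \<le> \<alpha>\<^sub>i\<^sub>i p\<^sub>j\<^sub>i\<close> for \<open>j \<noteq> i\<close>. Column \<open>i\<close> of \<open>A \<alpha> = 1\<close> says that
  \<open>y\<^sub>j = \<alpha>\<^sub>j\<^sub>i / \<alpha>\<^sub>i\<^sub>i\<close> is a fixed point of the Jacobi map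
  \<open>T(x)\<^sub>j = (|a\<^sub>j\<^sub>i| + \<Sum>\<^bsub>k \<noteq> j,i\<^esub> |a\<^sub>j\<^sub>k| x\<^sub>k) / |a\<^sub>j\<^sub>j|\<close>. By diagonal dominance a maximum principle holds:
  every \<open>x\<close> with \<open>T(x) \<le> x\<close>, called a majorant here, lies above \<open>y\<close>
  (lemma \<open>column_majorant_dominates\<close>). Being a majorant is the invariant of the whole
  iteration: the constant \<open>r\<^sub>i\<close> is a majorant, \<open>T\<close> maps majorants to majorants because it is
  monotone, and multiplication by \<open>h\<^sub>i\<close> keeps the property because the denominator in \<open>h\<^sub>i\<close>
  is precisely what one needs to rescale a majorant. The families \<open>m\<close>, \<open>u\<close>, \<open>p\<close> arise from \<open>r\<close> by
  these two operations alone.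
\<close>

section \<open>Cassini ovals\<close>

text \<open>
  Let \<open>i\<close> be the position of a largest entry of the eigenvector and \<open>j\<close> that of a largest one
  among the others. Row \<open>i\<close> of the eigenvalue equation is estimated with \<open>|v\<^sub>j|\<close>, row \<open>j\<close> with
  \<open>|v\<^sub>i|\<close>; in the product of the two estimates the entries of \<open>v\<close> cancel.
\<close>

lemma brauer_cassini:
  fixes B :: "complex mat"
  assumes B: "B \<in> carrier_mat n n" and n: "n \<ge> 2" and ev: "eigenvalue B l"
  obtains i j where "i < n" "j < n" "i \<noteq> j"
    "norm (l - B $$ (i, i)) * norm (l - B $$ (j, j))
       \<le> (\<Sum>k\<in>{..<n} - {i}. norm (B $$ (i, k))) * (\<Sum>k\<in>{..<n} - {j}. norm (B $$ (j, k)))"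
proof -
  obtain v where v: "v \<in> carrier_vec n" "v \<noteq> 0\<^sub>v n" "B *\<^sub>v v = l \<cdot>\<^sub>v v"
    using ev B unfolding eigenvalue_def eigenvector_def by auto
  let ?R = "\<lambda>i. \<Sum>k\<in>{..<n} - {i}. norm (B $$ (i, k))"
  have row: "(l - B $$ (i, i)) * v $ i = (\<Sum>k\<in>{..<n} - {i}. B $$ (i, k) * v $ k)"
    if i: "i < n" for i
  proof -
    have "(B *\<^sub>v v) $ i = l * v $ i" using v i by simp
    moreover have "(B *\<^sub>v v) $ i = (\<Sum>k<n. B $$ (i, k) * v $ k)"
      using B v(1) i by (simp add: scalar_prod_def atLeast0LessThan)
    moreover have "\<dots> = B $$ (i, i) * v $ i + (\<Sum>k\<in>{..<n} - {i}. B $$ (i, k) * v $ k)"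
      using i by (simp add: sum.remove)
    ultimately show ?thesis by (simp add: algebra_simps)
  qed
  have est: "norm (l - B $$ (i, i)) * norm (v $ i) \<le> ?R i * c"
    if i: "i < n" and c: "\<And>k. k < n \<Longrightarrow> k \<noteq> i \<Longrightarrow> norm (v $ k) \<le> c" for i c
  proof -
    have "norm (l - B $$ (i, i)) * norm (v $ i) = norm (\<Sum>k\<in>{..<n} - {i}. B $$ (i, k) * v $ k)"
      using row[OF i] by (metis norm_mult)
    also have "\<dots> \<le> (\<Sum>k\<in>{..<n} - {i}. norm (B $$ (i, k)) * c)"
      by (rule sum_norm_le) (auto simp: norm_mult intro!: mult_left_mono c)
    finally show ?thesis by (simp add: sum_distrib_right)
  qed
  obtain i where i: "i < n" and imax: "\<And>k. k < n \<Longrightarrow> norm (v $ k) \<le> norm (v $ i)"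
    using ex_is_arg_min_if_finite[of "{..<n}" "\<lambda>k. - norm (v $ k)"] n
    by (force simp: is_arg_min_linorder)
  have "{..<n} - {i} \<noteq> {}"
  proof
    assume "{..<n} - {i} = {}"
    then have "0 \<in> {i}" "1 \<in> {i}" using n by (force simp: subset_iff)+
    then show False by simp
  qed
  then obtain j where j: "j < n" "j \<noteq> i"
    and jmax: "\<And>k. k < n \<Longrightarrow> k \<noteq> i \<Longrightarrow> norm (v $ k) \<le> norm (v $ j)"
    using ex_is_arg_min_if_finite[of "{..<n} - {i}" "\<lambda>k. - norm (v $ k)"]
    by (force simp: is_arg_min_linorder)
  have vi: "norm (v $ i) > 0"
  proof (rule ccontr)
    assume "\<not> ?thesis"
    then have "v $ k = 0" if "k < n" for k
      using imax[OF that] by auto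
    then show False using v(1,2) by (metis eq_vecI carrier_vecD index_zero_vec)
  qed
  have ei: "norm (l - B $$ (i, i)) * norm (v $ i) \<le> ?R i * norm (v $ j)"
    by (rule est[OF i jmax])
  have ej: "norm (l - B $$ (j, j)) * norm (v $ j) \<le> ?R j * norm (v $ i)"
    by (rule est[OF j(1) imax])
  have R0: "?R k \<ge> 0" for k by (rule sum_nonneg) simp
  have "norm (l - B $$ (i, i)) * norm (l - B $$ (j, j)) \<le> ?R i * ?R j"
  \<comment> \<open>If \<open>v\<^sub>j = 0\<close>, then nothing can be cancelled, but \<open>v\<close> is a multiple of a unit vector
     and \<open>l\<close> is the diagonal entry.\<close>
  proof (cases "v $ j = 0")
    case True
    then have "norm (l - B $$ (i, i)) * norm (v $ i) \<le> 0" using ei by simp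
    then have "norm (l - B $$ (i, i)) = 0" using vi by (simp add: mult_le_0_iff)
    then show ?thesis using R0 by simp
  next
    case False
    have "(norm (l - B $$ (i, i)) * norm (v $ i)) * (norm (l - B $$ (j, j)) * norm (v $ j))
        \<le> (?R i * norm (v $ j)) * (?R j * norm (v $ i))"
      by (rule mult_mono[OF ei ej]) (auto simp: R0)
    then have "(norm (l - B $$ (i, i)) * norm (l - B $$ (j, j))) * (norm (v $ i) * norm (v $ j))
        \<le> (?R i * ?R j) * (norm (v $ i) * norm (v $ j))"
      by (simp add: mult_ac)
    moreover have "norm (v $ i) * norm (v $ j) > 0" using vi False by simp
    ultimately show ?thesis by (rule mult_right_le_imp_le)
  qed
  with i j show ?thesis by (intro that) auto
qed

text \<open>
  The distances of \<open>l\<close> to the centres are at least \<open>|l| - a\<close> and \<open>|l| - b\<close>; if both of these are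
  positive, \<open>|l|\<close> lies below the larger root of \<open>(x - a)(x - b) = c\<close>; and that root is at least
  \<open>max a b\<close>, which covers the remaining \<open>l\<close>.
\<close>

lemma cassini_oval_norm_bound:
  fixes l :: complex and a b c :: real
  assumes oval: "norm (l - of_real a) * norm (l - of_real b) \<le> c"
    and a: "0 \<le> a" and b: "0 \<le> b"
  shows "2 * norm l \<le> a + b + sqrt ((a - b)\<^sup>2 + 4 * c)"
proof -
  have c: "0 \<le> c" using oval by (meson mult_nonneg_nonneg norm_ge_zero order_trans)
  have ab: "\<bar>a - b\<bar> \<le> sqrt ((a - b)\<^sup>2 + 4 * c)"
    using c by (intro real_le_rsqrt) simp
  have la: "norm l - a \<le> norm (l - of_real a)" and lb: "norm l - b \<le> norm (l - of_real b)"
    using norm_triangle_ineq2[of l "of_real a"] norm_triangle_ineq2[of l "of_real b"] a b by auto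
  show ?thesis
  proof (cases "norm l \<le> a \<or> norm l \<le> b")
    case True
    then show ?thesis using ab by auto
  next
    case False
    then have "(norm l - a) * (norm l - b) \<le> norm (l - of_real a) * norm (l - of_real b)"
      using la lb by (intro mult_mono) auto
    with oval have "(norm l - a) * (norm l - b) \<le> c" by simp
    then have "(2 * norm l - a - b)\<^sup>2 \<le> (a - b)\<^sup>2 + 4 * c"
      by (simp add: power2_eq_square algebra_simps)
    then have "2 * norm l - a - b \<le> sqrt ((a - b)\<^sup>2 + 4 * c)" by (rule real_le_rsqrt)
    then show ?thesis by simp
  qed
qed

section \<open>Majorants of a column of the inverse\<close>

text \<open>
  This is \<open>T(x) \<le> x\<close> for the Jacobi map \<open>T\<close> of column \<open>i\<close>, cleared of the denominators \<open>|a\<^sub>j\<^sub>j|\<close>.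
\<close>

definition column_majorant :: "real mat \<Rightarrow> nat \<Rightarrow> (nat \<Rightarrow> real) \<Rightarrow> bool" where
  "column_majorant A i x \<longleftrightarrow>
     (\<forall>j<dim_row A. j \<noteq> i \<longrightarrow> \<bar>A $$ (j, i)\<bar> + off_sum A j i x \<le> \<bar>A $$ (j, j)\<bar> * x j)"

lemma off_sum_mono:
  assumes "\<And>k. k < dim_row A \<Longrightarrow> k \<noteq> j \<Longrightarrow> k \<noteq> i \<Longrightarrow> f k \<le> g k"
  shows "off_sum A j i f \<le> off_sum A j i g"
  unfolding off_sum_def using assms by (intro sum_mono mult_left_mono) auto

lemma off_sum_mult_right: "off_sum A j i (\<lambda>k. f k * c) = off_sum A j i f * c"
  unfolding off_sum_def by (simp add: sum_distrib_right mult.assoc)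

lemma off_sum_nonneg: "(\<And>k. 0 \<le> f k) \<Longrightarrow> 0 \<le> off_sum A j i f"
  unfolding off_sum_def by (intro sum_nonneg) auto

text \<open>
  For each \<open>i\<close>, the matrix that remains after deleting row and column \<open>i\<close> is strictly diagonally
  dominant. This is weaker than strict dominance of \<open>A\<close> itself.
\<close>

definition row_dominant :: "real mat \<Rightarrow> bool" where
  "row_dominant A \<longleftrightarrow>
     (\<forall>i<dim_row A. \<forall>j<dim_row A. j \<noteq> i \<longrightarrow> off_sum A j i (\<lambda>_. 1) < \<bar>A $$ (j, j)\<bar>)"

lemma row_dominant_diag_pos:
  assumes "row_dominant A" "i < dim_row A" "j < dim_row A" "j \<noteq> i"
  shows "0 < \<bar>A $$ (j, j)\<bar>"
  using assms off_sum_nonneg[of "\<lambda>_. 1" A j i] unfolding row_dominant_def by fastforce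

text \<open>
  Maximum principle: at a position \<open>l\<close> where \<open>x - y\<close> is smallest, the inequality for \<open>x\<close> and the
  equation for \<open>y\<close> give \<open>|a\<^sub>l\<^sub>l| (x\<^sub>l - y\<^sub>l) \<ge> (\<Sum>\<^bsub>k \<noteq> l,i\<^esub> |a\<^sub>l\<^sub>k|) (x\<^sub>l - y\<^sub>l)\<close>, and dominance makes
  this impossible for a negative difference.
\<close>

lemma column_majorant_dominates:
  assumes dom: "row_dominant A" and i: "i < dim_row A"
    and x: "column_majorant A i x"
    and y: "\<And>j. j < dim_row A \<Longrightarrow> j \<noteq> i \<Longrightarrow>
              \<bar>A $$ (j, j)\<bar> * y j = \<bar>A $$ (j, i)\<bar> + off_sum A j i y"
    and j: "j < dim_row A" "j \<noteq> i"
  shows "y j \<le> x j"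
proof -
  obtain l where l: "l < dim_row A" "l \<noteq> i"
    and lmin: "\<And>k. k < dim_row A \<Longrightarrow> k \<noteq> i \<Longrightarrow> x l - y l \<le> x k - y k"
    using ex_is_arg_min_if_finite[of "{..<dim_row A} - {i}" "\<lambda>k. x k - y k"] j
    by (force simp: is_arg_min_linorder)
  have "off_sum A l i (\<lambda>_. 1) * (x l - y l) = off_sum A l i (\<lambda>k. 1 * (x l - y l))"
    by (rule off_sum_mult_right[symmetric])
  also have "\<dots> \<le> off_sum A l i (\<lambda>k. x k - y k)"
    using lmin by (intro off_sum_mono) auto
  also have "\<dots> = off_sum A l i x - off_sum A l i y"
    by (simp add: off_sum_def sum_subtractf algebra_simps)
  also have "\<dots> \<le> \<bar>A $$ (l, l)\<bar> * (x l - y l)"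
    using x l y[OF l] by (auto simp: column_majorant_def algebra_simps)
  finally have "0 \<le> (\<bar>A $$ (l, l)\<bar> - off_sum A l i (\<lambda>_. 1)) * (x l - y l)"
    by (simp add: algebra_simps)
  moreover have "0 < \<bar>A $$ (l, l)\<bar> - off_sum A l i (\<lambda>_. 1)"
    using dom i l by (auto simp: row_dominant_def)
  ultimately have "0 \<le> x l - y l" by (simp add: zero_le_mult_iff)
  with lmin[OF j] show ?thesis by simp
qed

text \<open>
  From \<open>T(x) \<le> x\<close> and monotonicity of \<open>T\<close> it follows that \<open>T(T(x)) \<le> T(x)\<close>.
\<close>

lemma column_majorant_jacobi_step:
  assumes dom: "row_dominant A" and i: "i < dim_row A" and x: "column_majorant A i x"
  shows "column_majorant A i (\<lambda>j. (\<bar>A $$ (j, i)\<bar> + off_sum A j i x) / \<bar>A $$ (j, j)\<bar>)"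
    (is "column_majorant A i ?T")
proof -
  have "\<bar>A $$ (j, i)\<bar> + off_sum A j i ?T \<le> \<bar>A $$ (j, j)\<bar> * ?T j"
    if j: "j < dim_row A" "j \<noteq> i" for j
  proof -
    have "?T k \<le> x k" if "k < dim_row A" "k \<noteq> i" for k
      using x that row_dominant_diag_pos[OF dom i that]
      by (auto simp: column_majorant_def divide_le_eq mult.commute)
    then have "off_sum A j i ?T \<le> off_sum A j i x" by (intro off_sum_mono)
    then show ?thesis using row_dominant_diag_pos[OF dom i j] by simp
  qed
  then show ?thesis by (simp add: column_majorant_def)
qed

text \<open>
  \<open>r\<^sub>i\<close> is the least constant that is a majorant: for a constant \<open>c\<close> the condition in
  row \<open>j\<close> reads \<open>|a\<^sub>j\<^sub>i| \<le> c (|a\<^sub>j\<^sub>j| - \<Sum>\<^bsub>k \<noteq> j,i\<^esub> |a\<^sub>j\<^sub>k|)\<close>. This starts the iteration.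
\<close>

lemma column_majorant_r_coef:
  assumes dom: "row_dominant A" and i: "i < dim_row A"
  shows "column_majorant A i (\<lambda>_. r_coef A i)"
proof -
  have "\<bar>A $$ (j, i)\<bar> + off_sum A j i (\<lambda>_. r_coef A i) \<le> \<bar>A $$ (j, j)\<bar> * r_coef A i"
    if j: "j < dim_row A" "j \<noteq> i" for j
  proof -
    have "\<bar>A $$ (j, i)\<bar> / (\<bar>A $$ (j, j)\<bar> - off_sum A j i (\<lambda>_. 1)) \<le> r_coef A i"
      unfolding r_coef_def using j by (intro Max_ge) auto
    moreover have "0 < \<bar>A $$ (j, j)\<bar> - off_sum A j i (\<lambda>_. 1)"
      using dom i j by (auto simp: row_dominant_def)
    ultimately have "\<bar>A $$ (j, i)\<bar> \<le> r_coef A i * (\<bar>A $$ (j, j)\<bar> - off_sum A j i (\<lambda>_. 1))"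
      by (simp add: divide_le_eq)
    then show ?thesis
      using off_sum_mult_right[of A j i "\<lambda>_. 1" "r_coef A i"] by (simp add: algebra_simps)
  qed
  then show ?thesis by (simp add: column_majorant_def)
qed

lemma column_majorant_m_coef:
  assumes "row_dominant A" "i < dim_row A"
  shows "column_majorant A i (\<lambda>j. m_coef A j i)"
  unfolding m_coef_def
  using assms by (intro column_majorant_jacobi_step column_majorant_r_coef)

text \<open>
  \<open>x\<close> times a constant \<open>c\<close> is a majorant iff \<open>|a\<^sub>j\<^sub>i| \<le> c d\<^sub>j\<close> in each row \<open>j\<close>, where \<open>d\<^sub>j\<close> is the
  denominator occurring in \<open>h\<^sub>i\<close>; so \<open>h\<^sub>i\<close> is the natural choice for \<open>c\<close>. As \<open>x\<close> is a majorant, \<open>d\<^sub>j \<ge> |a\<^sub>j\<^sub>i|\<close>;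
  hence where \<open>d\<^sub>j = 0\<close>, the condition reads \<open>0 \<le> 0\<close>.
\<close>

lemma column_majorant_h_of:
  assumes x: "column_majorant A i (\<lambda>k. x k i)"
  shows "column_majorant A i (\<lambda>k. x k i * h_of A x i)"
proof -
  have "\<bar>A $$ (j, i)\<bar> + off_sum A j i (\<lambda>k. x k i * h_of A x i) \<le> \<bar>A $$ (j, j)\<bar> * (x j i * h_of A x i)"
    if j: "j < dim_row A" "j \<noteq> i" for j
  proof -
    define d where "d = \<bar>A $$ (j, j)\<bar> * x j i - off_sum A j i (\<lambda>k. x k i)"
    have ad: "\<bar>A $$ (j, i)\<bar> \<le> d" using x j by (auto simp: column_majorant_def d_def)
    have "\<bar>A $$ (j, i)\<bar> / d \<le> h_of A x i"
      unfolding h_of_def d_def using j by (intro Max_ge) auto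
    then have "\<bar>A $$ (j, i)\<bar> \<le> h_of A x i * d"
      using ad by (cases "d = 0") (auto simp: divide_le_eq split: if_splits)
    then show ?thesis by (simp add: off_sum_mult_right d_def algebra_simps)
  qed
  then show ?thesis by (simp add: column_majorant_def)
qed

lemma column_majorant_u_of:
  assumes "row_dominant A" "i < dim_row A" "column_majorant A i (\<lambda>k. x k i)"
  shows "column_majorant A i (\<lambda>j. u_of A x j i)"
  unfolding u_of_def
  using assms by (intro column_majorant_jacobi_step column_majorant_h_of)

lemma column_majorant_p_of:
  assumes "row_dominant A" "i < dim_row A" "column_majorant A i (\<lambda>k. u k i)"
  shows "column_majorant A i (\<lambda>j. p_of A u j i)"
  unfolding p_of_def
  using assms by (intro column_majorant_jacobi_step)

lemma column_majorant_u_iter: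
  assumes "row_dominant A" "i < dim_row A"
  shows "column_majorant A i (\<lambda>j. u_iter A t j i)"
  using assms
  by (induction t) (simp_all add: column_majorant_u_of column_majorant_p_of column_majorant_m_coef)

lemma column_majorant_p_iter:
  assumes "row_dominant A" "i < dim_row A"
  shows "column_majorant A i (\<lambda>j. p_iter A t j i)"
  unfolding p_iter_def using assms by (intro column_majorant_p_of column_majorant_u_iter)

section \<open>The inverse of a nonsingular M-matrix\<close>

lemma inv_mat_correct:
  assumes A: "A \<in> carrier_mat n n" and inv: "invertible_mat A"
  shows "inv_mat A \<in> carrier_mat n n" "A * inv_mat A = 1\<^sub>m n"
proof -
  obtain B where AB: "A * B = 1\<^sub>m (dim_row A)" and BA: "B * A = 1\<^sub>m (dim_row B)"
    using inv by (auto simp: invertible_mat_def inverts_mat_def)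
  have "B \<in> carrier_mat n n"
    using A AB BA
    by (metis carrier_matD carrier_mat_triv index_mult_mat(2,3) index_one_mat(2,3))
  with A AB BA have "A \<in> Units (ring_mat TYPE(real) n ())"
    by (auto simp: Units_def ring_mat_def)
  with mat_inverse(1)[OF A, of "()"] obtain C where C: "mat_inverse A = Some C"
    by (cases "mat_inverse A") auto
  with mat_inverse(2)[OF A C]
  show "inv_mat A \<in> carrier_mat n n" "A * inv_mat A = 1\<^sub>m n"
    by (auto simp: inv_mat_def)
qed

text \<open>
  The entries of \<open>A \<alpha> = 1\<close>, with the off-diagonal terms, whose factors \<open>a\<^sub>j\<^sub>k\<close> are \<open>\<le> 0\<close>, moved to
  the right.
\<close>

lemma M_matrix_inverse_entries:
  assumes A: "A \<in> nonsingular_M_matrices n" and i: "i < n" and j: "j < n"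
  shows "A $$ (j, j) * inv_mat A $$ (j, i) =
           (if j = i then 1 else 0) + (\<Sum>k\<in>{..<n} - {j}. \<bar>A $$ (j, k)\<bar> * inv_mat A $$ (k, i))"
proof -
  have Ac: "A \<in> carrier_mat n n" and inv: "invertible_mat A"
    and Z: "\<And>k. k < n \<Longrightarrow> j \<noteq> k \<Longrightarrow> A $$ (j, k) \<le> 0"
    using A j by (auto simp: nonsingular_M_matrices_def)
  note C = inv_mat_correct[OF Ac inv]
  have "(if j = i then 1 else 0) = (A * inv_mat A) $$ (j, i)"
    using C(2) i j by simp
  also have "\<dots> = (\<Sum>k<n. A $$ (j, k) * inv_mat A $$ (k, i))"
    using Ac C(1) i j by (simp add: scalar_prod_def atLeast0LessThan)
  also have "\<dots> = A $$ (j, j) * inv_mat A $$ (j, i)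
      + (\<Sum>k\<in>{..<n} - {j}. A $$ (j, k) * inv_mat A $$ (k, i))"
    using j by (simp add: sum.remove)
  also have "(\<Sum>k\<in>{..<n} - {j}. A $$ (j, k) * inv_mat A $$ (k, i))
      = - (\<Sum>k\<in>{..<n} - {j}. \<bar>A $$ (j, k)\<bar> * inv_mat A $$ (k, i))"
    unfolding sum_negf[symmetric] using Z by (intro sum.cong) auto
  finally show ?thesis by simp
qed

lemma M_matrix_inverse_nonneg:
  assumes "A \<in> nonsingular_M_matrices n" "i < n" "j < n"
  shows "0 \<le> inv_mat A $$ (i, j)"
  using assms inv_mat_correct(1)[of A n]
  by (auto simp: nonsingular_M_matrices_def nonneg_mat_def)

lemma M_matrix_diag_pos:
  assumes A: "A \<in> nonsingular_M_matrices n" and i: "i < n"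
  shows "0 < A $$ (i, i)" "0 < inv_mat A $$ (i, i)"
proof -
  have "0 \<le> (\<Sum>k\<in>{..<n} - {i}. \<bar>A $$ (i, k)\<bar> * inv_mat A $$ (k, i))"
    using M_matrix_inverse_nonneg[OF A] i by (intro sum_nonneg mult_nonneg_nonneg) auto
  then have "0 < A $$ (i, i) * inv_mat A $$ (i, i)"
    using M_matrix_inverse_entries[OF A i i] by simp
  with M_matrix_inverse_nonneg[OF A i i]
  show "0 < A $$ (i, i)" "0 < inv_mat A $$ (i, i)"
    by (auto simp: zero_less_mult_iff)
qed

text \<open>
  The scaled column \<open>\<alpha>\<^sub>j\<^sub>i / \<alpha>\<^sub>i\<^sub>i\<close> is the fixed point of the Jacobi map, so the maximum principle
  compares it with any majorant.
\<close>

lemma M_matrix_inverse_column_le: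
  assumes A: "A \<in> nonsingular_M_matrices n" and dom: "row_dominant A"
    and i: "i < n" and j: "j < n" "j \<noteq> i"
    and x: "column_majorant A i x"
  shows "inv_mat A $$ (j, i) \<le> inv_mat A $$ (i, i) * x j"
proof -
  let ?c = "inv_mat A $$ (i, i)"
  have dim: "dim_row A = n" using A by (auto simp: nonsingular_M_matrices_def)
  have c: "0 < ?c" by (rule M_matrix_diag_pos(2)[OF A i])
  have "\<bar>A $$ (l, l)\<bar> * (inv_mat A $$ (l, i) / ?c)
      = \<bar>A $$ (l, i)\<bar> + off_sum A l i (\<lambda>k. inv_mat A $$ (k, i) / ?c)"
    if l: "l < n" "l \<noteq> i" for l
  proof -
    have "{..<n} - {l} = insert i ({..<n} - {l, i})" using i l by auto
    then have "(\<Sum>k\<in>{..<n} - {l}. \<bar>A $$ (l, k)\<bar> * inv_mat A $$ (k, i))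
        = \<bar>A $$ (l, i)\<bar> * ?c + off_sum A l i (\<lambda>k. inv_mat A $$ (k, i))"
      by (simp add: off_sum_def dim)
    then have "A $$ (l, l) * inv_mat A $$ (l, i)
        = \<bar>A $$ (l, i)\<bar> * ?c + off_sum A l i (\<lambda>k. inv_mat A $$ (k, i))"
      using M_matrix_inverse_entries[OF A i l(1)] l by simp
    then show ?thesis
      using c M_matrix_diag_pos(1)[OF A l(1)]
        off_sum_mult_right[of A l i "\<lambda>k. inv_mat A $$ (k, i)" "1 / ?c"]
      by (simp add: field_simps)
  qed
  then have "inv_mat A $$ (j, i) / ?c \<le> x j"
    using column_majorant_dominates[OF dom _ x, of "\<lambda>l. inv_mat A $$ (l, i) / ?c" j] i j
    by (simp add: dim)
  then show ?thesis using c by (simp add: divide_le_eq mult.commute)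
qed

text \<open>
  Needed for inverting the bound on the spectral radius, since \<open>\<tau>\<close> would be \<open>0\<close> by the
  convention for \<open>inverse 0\<close> if that radius vanished.
\<close>

lemma left_invertible_spectral_radius_pos:
  fixes C :: "complex mat"
  assumes C: "C \<in> carrier_mat n n" and D: "D \<in> carrier_mat n n" and DC: "D * C = 1\<^sub>m n"
    and n: "n > 0"
  shows "0 < spectral_radius C"
proof -
  obtain l where l: "eigenvalue C l" "spectral_radius C = norm l"
    using spectral_radius_mem_max(1)[OF C n] by (auto simp: spectrum_def)
  obtain v where v: "v \<in> carrier_vec n" "v \<noteq> 0\<^sub>v n" "C *\<^sub>v v = l \<cdot>\<^sub>v v"
    using l(1) C by (auto simp: eigenvalue_def eigenvector_def)
  have "l \<noteq> 0"
  proof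
    assume "l = 0"
    have "v = (D * C) *\<^sub>v v" using v by (simp add: DC)
    also have "\<dots> = D *\<^sub>v (C *\<^sub>v v)" using C D v by simp
    also have "C *\<^sub>v v = 0\<^sub>v n" using v \<open>l = 0\<close> by auto
    also have "D *\<^sub>v 0\<^sub>v n = 0\<^sub>v n" using D by (auto intro: eq_vecI)
    finally show False using v by simp
  qed
  with l show ?thesis by simp
qed

section \<open>The lower bound for the minimum eigenvalue\<close>

theorem theorem2:
  fixes A \<alpha> :: "real mat" and n t :: nat
  assumes "n \<ge> 2"
    and "A \<in> nonsingular_M_matrices n"
    and "\<alpha> = inv_mat A"
    and well_defined: "\<And>i j. i < n \<Longrightarrow> j < n \<Longrightarrow> i \<noteq> j \<Longrightarrow>
           \<bar>A $$ (j, j)\<bar> - (\<Sum>k \<in> {..<n} - {j, i}. \<bar>A $$ (j, k)\<bar>) > 0"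
    and "t \<ge> 1"
  shows "tau A \<ge> 2 / Max {\<alpha> $$ (i, i) + \<alpha> $$ (j, j) +
           sqrt ((\<alpha> $$ (i, i) - \<alpha> $$ (j, j))\<^sup>2 +
                 4 * \<alpha> $$ (i, i) * \<alpha> $$ (j, j) *
                 (\<Sum>k \<in> {..<n} - {i}. p_iter A t k i) *
                 (\<Sum>k \<in> {..<n} - {j}. p_iter A t k j))
           | i j. i < n \<and> j < n \<and> i \<noteq> j}"
proof -
  let ?P = "\<lambda>i. \<Sum>k \<in> {..<n} - {i}. p_iter A t k i"
  define b where "b = (\<lambda>(i, j). \<alpha> $$ (i, i) + \<alpha> $$ (j, j) +
    sqrt ((\<alpha> $$ (i, i) - \<alpha> $$ (j, j))\<^sup>2 + 4 * \<alpha> $$ (i, i) * \<alpha> $$ (j, j) * ?P i * ?P j))"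
  define S where "S = b ` {(i, j). i < n \<and> j < n \<and> i \<noteq> j}"
  have A: "A \<in> carrier_mat n n" "invertible_mat A"
    using assms(2) by (auto simp: nonsingular_M_matrices_def)
  note \<alpha> = inv_mat_correct[OF A, folded assms(3)]
  have dom: "row_dominant A"
    using well_defined A(1) by (auto simp: row_dominant_def off_sum_def)
  define C where "C = map_mat complex_of_real \<alpha>"
  have C: "C \<in> carrier_mat n n" using \<alpha>(1) by (simp add: C_def)
  have "map_mat complex_of_real A * C = map_mat complex_of_real (A * \<alpha>)"
    unfolding C_def using A(1) \<alpha>(1) by (rule of_real_hom.mat_hom_mult[symmetric])
  also have "\<dots> = 1\<^sub>m n" by (simp add: \<alpha>(2) of_real_hom.mat_hom_one)
  finally have pos: "0 < spectral_radius C"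
    using left_invertible_spectral_radius_pos[OF C, of "map_mat complex_of_real A"] A(1) assms(1)
    by simp
  obtain l where l: "eigenvalue C l" "spectral_radius C = norm l"
    using spectral_radius_mem_max(1)[OF C] assms(1) by (auto simp: spectrum_def)
  \<comment> \<open>The majorants control columns of the inverse, and \<open>brauer_cassini\<close> speaks of rows.\<close>
  have "eigenvalue (transpose_mat C) l"
    using l(1) C by (simp add: eigenvalue_root_char_poly[of _ n])
  then obtain i j where ij: "i < n" "j < n" "i \<noteq> j" and oval:
    "norm (l - transpose_mat C $$ (i, i)) * norm (l - transpose_mat C $$ (j, j))
       \<le> (\<Sum>k\<in>{..<n} - {i}. norm (transpose_mat C $$ (i, k)))
         * (\<Sum>k\<in>{..<n} - {j}. norm (transpose_mat C $$ (j, k)))"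
    using brauer_cassini[of "transpose_mat C" n l] C assms(1) by auto
  have R: "(\<Sum>k\<in>{..<n} - {i}. norm (transpose_mat C $$ (i, k))) \<le> \<alpha> $$ (i, i) * ?P i"
    if i: "i < n" for i
  proof -
    have "norm (transpose_mat C $$ (i, k)) \<le> \<alpha> $$ (i, i) * p_iter A t k i"
      if k: "k \<in> {..<n} - {i}" for k
      using M_matrix_inverse_column_le[OF assms(2) dom i _ _ column_majorant_p_iter[OF dom], of k t]
        M_matrix_inverse_nonneg[OF assms(2), of k i] A(1) \<alpha>(1) i k
      by (simp add: C_def assms(3))
    then show ?thesis unfolding sum_distrib_left by (rule sum_mono)
  qed
  from oval have "norm (l - transpose_mat C $$ (i, i)) * norm (l - transpose_mat C $$ (j, j))
       \<le> (\<alpha> $$ (i, i) * ?P i) * (\<alpha> $$ (j, j) * ?P j)"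
    by (elim order_trans, intro mult_mono)
      (auto intro!: R ij sum_nonneg order_trans[OF sum_nonneg R])
  then have "2 * norm l \<le> b (i, j)"
    using cassini_oval_norm_bound[of l "\<alpha> $$ (i, i)" "\<alpha> $$ (j, j)"
        "(\<alpha> $$ (i, i) * ?P i) * (\<alpha> $$ (j, j) * ?P j)"]
      ij C \<alpha>(1) M_matrix_diag_pos(2)[OF assms(2)]
    by (simp add: C_def b_def assms(3) less_imp_le mult_ac)
  also have "b (i, j) \<le> Max S"
  proof (rule Max_ge)
    show "finite S" unfolding S_def
      by (rule finite_imageI, rule finite_subset[of _ "{..<n} \<times> {..<n}"]) auto
  qed (use ij in \<open>auto simp: S_def\<close>)
  finally have le: "2 * norm l \<le> Max S" .
  have "0 < 2 * norm l" using pos l(2) by linarith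
  with le have "2 / Max S \<le> 2 / (2 * norm l)" by (intro frac_le) linarith+
  also have "\<dots> = inverse (norm l)" by (simp add: inverse_eq_divide)
  finally have "2 / Max S \<le> inverse (norm l)" .
  then have "2 / Max S \<le> tau A"
    using l(2) by (simp add: tau_def C_def assms(3))
  moreover have "S = {b (i, j) | i j. i < n \<and> j < n \<and> i \<noteq> j}"
    by (auto simp: S_def)
  ultimately show ?thesis by (simp add: b_def)
qed

end
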